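(* Let $G=(V,E)$ be a simple, connected, undirected graph with $n\ge 2$ nodes and $m$ edges, let $\Gamma$ be the set of spanning trees of $G$, and fix a node $r\in V$. Then $$\kappa(G)=\frac{1}{2m|\Gamma|}\sum_{u\in V,\,u\neq r} d(u)\sum_{\substack{T_1\cup T_2\in\mathbb{F}_{r\mid u}\\ r\in T_1}}\mathrm{vol}(T_1),$$ where in the inner sum, for each 2-forest in $\mathbb{F}_{r\mid u}$, $T_1$ denotes the node set of its tree containing $r$.
   Context: $d(v)$ is the degree of $v$ in $G$, and for $S\subseteq V$, $\mathrm{vol}(S)=\sum_{v\in S}d(v)$ (degrees taken in $G$). The Kemeny constant is $\kappa(G)=\sum_{j\in V}\pi_j H(i,j)$, where $\pi_j=d(j)/(2m)$, $H(i,j)$ is the expected hitting time of $j$ by the simple random walk on $G$ (transition matrix $D^{-1}A$) started at $i$, and this quantity is independent of $i$; equivalently $\kappa(G)=\mathrm{Tr}(\mathcal{L}^{\dagger})=\sum_{i=2}^n 1/\sigma_i$, where $\mathcal{L}=I-D^{-1/2}AD^{-1/2}$ has eigenvalues $0=\sigma_1\le\sigma_2\le\dots\le\sigma_n$. A 2-forest of $G$ is a spanning forest of $G$ (an acyclic subgraph containing all nodes) with exactly two connected components (trees); we write it as $T_1\cup T_2$ with $T_1,T_2$ the node sets of its two trees. $\mathbb{F}_{r\mid u}$ is the set of 2-forests of $G$ in which $r$ and $u$ lie in different trees. *)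

theory Defs
  imports "HOL-Probability.Probability"
begin

section \<open>Simple graphs\<close>

definition simple_graph :: "'a set \<Rightarrow> 'a set set \<Rightarrow> bool" where
  "simple_graph V E \<longleftrightarrow> finite V \<and> (\<forall>e\<in>E. e \<subseteq> V \<and> card e = 2)"

text \<open>For an edge set \<open>F\<close> the graph \<open>(V, F)\<close> is the spanning subgraph with
  edges \<open>F\<close>; in particular, spanning subgraphs are identified with their edge sets.\<close>

definition adj_rel :: "'a set set \<Rightarrow> ('a \<times> 'a) set" where
  "adj_rel F = {(u, v). {u, v} \<in> F}"

definition neighbours :: "'a set set \<Rightarrow> 'a \<Rightarrow> 'a set" where
  "neighbours F v = {w. {v, w} \<in> F}"

definition deg :: "'a set set \<Rightarrow> 'a \<Rightarrow> nat" where
  "deg F v = card (neighbours F v)"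

definition vol :: "'a set set \<Rightarrow> 'a set \<Rightarrow> nat" where
  "vol E S = (\<Sum>v\<in>S. deg E v)"

definition component_of :: "'a set \<Rightarrow> 'a set set \<Rightarrow> 'a \<Rightarrow> 'a set" where
  "component_of V F v = {w \<in> V. (v, w) \<in> (adj_rel F)\<^sup>*}"

definition components_of :: "'a set \<Rightarrow> 'a set set \<Rightarrow> 'a set set" where
  "components_of V F = component_of V F ` V"

definition connected_graph :: "'a set \<Rightarrow> 'a set set \<Rightarrow> bool" where
  "connected_graph V F \<longleftrightarrow> V \<noteq> {} \<and> (\<forall>u\<in>V. \<forall>v\<in>V. (u, v) \<in> (adj_rel F)\<^sup>*)"

definition is_cycle :: "'a set set \<Rightarrow> 'a list \<Rightarrow> bool" where
  "is_cycle F xs \<longleftrightarrow> 3 \<le> length xs \<and> distinct xs \<and>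
     (\<forall>i<length xs. {xs ! i, xs ! (Suc i mod length xs)} \<in> F)"

definition acyclic_graph :: "'a set set \<Rightarrow> bool" where
  "acyclic_graph F \<longleftrightarrow> \<not> (\<exists>xs. is_cycle F xs)"

section \<open>Spanning trees and 2-forests\<close>

definition spanning_trees :: "'a set \<Rightarrow> 'a set set \<Rightarrow> 'a set set set" where
  "spanning_trees V E = {F. F \<subseteq> E \<and> acyclic_graph F \<and> connected_graph V F}"

definition two_forests :: "'a set \<Rightarrow> 'a set set \<Rightarrow> 'a set set set" where
  "two_forests V E = {F. F \<subseteq> E \<and> acyclic_graph F \<and> card (components_of V F) = 2}"

definition two_forests_separating :: "'a set \<Rightarrow> 'a set set \<Rightarrow> 'a \<Rightarrow> 'a \<Rightarrow> 'a set set set" where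
  "two_forests_separating V E r u =
     {F \<in> two_forests V E. component_of V F r \<noteq> component_of V F u}"

section \<open>Simple random walk, hitting times and the Kemeny constant\<close>

text \<open>\<open>srw_kernel E i t \<omega>\<close> is the conditional law of the position at time \<open>t\<close> given the
  positions \<open>\<omega> 0, \<dots>, \<omega> (t - 1)\<close>: the start \<open>i\<close> at time \<open>0\<close>, and afterwards a uniformly
  chosen neighbour of the previous position. On an isolated vertex \<open>pmf_of_set {}\<close> is unspecified;
  this does not occur in a connected graph with at least two vertices.\<close>

definition srw_kernel :: "'a set set \<Rightarrow> 'a \<Rightarrow> nat \<Rightarrow> (nat \<Rightarrow> 'a) \<Rightarrow> 'a measure" where
  "srw_kernel E i t \<omega> = measure_pmf
     (case t of 0 \<Rightarrow> return_pmf i | Suc s \<Rightarrow> pmf_of_set (neighbours E (\<omega> s)))"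

text \<open>The law of the whole trajectory, as a measure on \<open>nat \<Rightarrow> 'a\<close>, is the measure that the
  theorem of Ionescu-Tulcea constructs from these kernels.\<close>

lemma srw_Ionescu_Tulcea:
  fixes E :: "'a set set"
  shows "Ionescu_Tulcea (srw_kernel E i) (\<lambda>_. count_space UNIV)"
proof (rule Ionescu_Tulcea.intro)
  show "srw_kernel E i t \<in> measurable (PiM {0..<t} (\<lambda>_. count_space UNIV))
          (subprob_algebra (count_space UNIV))" for t
  proof (cases t)
    case 0
    then have "srw_kernel E i t = (\<lambda>_. measure_pmf (return_pmf i))"
      by (simp add: srw_kernel_def fun_eq_iff)
    then show ?thesis
      by (auto simp: space_subprob_algebra
          intro!: measurable_const measure_pmf.subprob_space_axioms)
  next
    case (Suc s)
    have kernel: "(\<lambda>x. measure_pmf (pmf_of_set (neighbours E x)))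
        \<in> measurable (count_space UNIV) (subprob_algebra (count_space UNIV))"
      by (auto simp: space_subprob_algebra intro: measure_pmf.subprob_space_axioms)
    have proj: "(\<lambda>\<omega>. \<omega> s)
        \<in> measurable (PiM {0..<t} (\<lambda>_. count_space UNIV)) (count_space (UNIV :: 'a set))"
      using Suc by (intro measurable_component_singleton) auto
    have eq: "srw_kernel E i t = (\<lambda>\<omega>. measure_pmf (pmf_of_set (neighbours E (\<omega> s))))"
      by (simp add: srw_kernel_def fun_eq_iff Suc)
    show ?thesis
      unfolding eq by (rule measurable_compose[OF proj kernel])
  qed
  show "prob_space (srw_kernel E i t \<omega>)" for t \<omega>
    by (simp add: srw_kernel_def measure_pmf.prob_space_axioms)
qed

definition srw_measure :: "'a set set \<Rightarrow> 'a \<Rightarrow> (nat \<Rightarrow> 'a) measure" where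
  "srw_measure E i = projective_family.lim UNIV
     (Ionescu_Tulcea.CI (srw_kernel E i) (\<lambda>_. count_space UNIV)) (\<lambda>_. count_space UNIV)"

definition first_hit :: "'a \<Rightarrow> (nat \<Rightarrow> 'a) \<Rightarrow> enat" where
  "first_hit j \<omega> = Inf {enat t | t. \<omega> t = j}"

definition hitting_time :: "'a set set \<Rightarrow> 'a \<Rightarrow> 'a \<Rightarrow> ennreal" where
  "hitting_time E i j = (\<integral>\<^sup>+\<omega>. ennreal_of_enat (first_hit j \<omega>) \<partial>srw_measure E i)"

text \<open>The sum \<open>\<Sum>\<^sub>j \<pi>\<^sub>j H(i, j)\<close>. The starting vertex \<open>i\<close> is kept as an argument; the value does
  not depend on it in a connected graph.\<close>

definition kemeny :: "'a set \<Rightarrow> 'a set set \<Rightarrow> 'a \<Rightarrow> ennreal" where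
  "kemeny V E i =
     (\<Sum>j\<in>V. ennreal (real (deg E j) / (2 * real (card E))) * hitting_time E i j)"

end

theory Submission
  imports Defs
begin

text \<open>Let \<open>W\<^sub>j(i)\<close> be the sum of \<open>vol(T\<^sub>i)\<close> over the 2-forests separating \<open>i\<close> from \<open>j\<close>, where
  \<open>T\<^sub>i\<close> is the tree containing \<open>i\<close>. In \<open>\<Sum>\<^sub>k (W\<^sub>j(i) - W\<^sub>j(k))\<close>, taken over the neighbours \<open>k\<close> of
  \<open>i\<close>, only the 2-forests separating \<open>i\<close> from \<open>k\<close> contribute, and these are the spanning trees through
  the edge \<open>ik\<close> with that edge removed. For a fixed spanning tree the branches at \<open>i\<close> partition
  \<open>V - {i}\<close>, so the sum equals \<open>|\<Gamma>| (d(i) - [i = j] vol(V))\<close>.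

  For \<open>i \<noteq> j\<close> this is the first-step equation for the hitting time of \<open>j\<close>, so
  \<open>H(i, j) = W\<^sub>j(i) / |\<Gamma>|\<close> by the maximum principle. Weighting the identity by \<open>d(j)\<close> and summing
  over \<open>j\<close> gives \<open>0\<close>: the Kemeny sum is harmonic in its starting vertex, hence constant, and
  may be evaluated at \<open>r\<close>.\<close>

subsection \<open>Reachability\<close>

lemma sym_adj_rel_rtrancl: "(u, v) \<in> (adj_rel F)\<^sup>* \<Longrightarrow> (v, u) \<in> (adj_rel F)\<^sup>*"
  by (rule symD[OF sym_rtrancl]) (auto simp: sym_def adj_rel_def insert_commute)

lemma adj_rel_rtrancl_mono: "F \<subseteq> F' \<Longrightarrow> (u, v) \<in> (adj_rel F)\<^sup>* \<Longrightarrow> (u, v) \<in> (adj_rel F')\<^sup>*"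
  by (rule subsetD[OF rtrancl_mono]) (auto simp: adj_rel_def)

lemma adj_rel_edge: "{u, v} \<in> F \<Longrightarrow> (u, v) \<in> (adj_rel F)\<^sup>*"
  by (auto simp: adj_rel_def)

lemma adj_rel_rtrancl_insert:
  assumes "(a, b) \<in> (adj_rel (insert {i, k} F))\<^sup>*"
  shows "(a, b) \<in> (adj_rel F)\<^sup>* \<or> (a, i) \<in> (adj_rel F)\<^sup>* \<and> (k, b) \<in> (adj_rel F)\<^sup>*
    \<or> (a, k) \<in> (adj_rel F)\<^sup>* \<and> (i, b) \<in> (adj_rel F)\<^sup>*"
  using assms
proof (induction rule: rtrancl_induct)
  case base
  then show ?case by simp
next
  case (step b c)
  show ?case
  proof (cases "{b, c} \<in> F")
    case True
    then show ?thesis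
      using step.IH rtrancl_trans[OF _ adj_rel_edge[OF True]] by blast
  next
    case False
    then have "b = i \<and> c = k \<or> b = k \<and> c = i"
      using step.hyps by (auto simp: adj_rel_def doubleton_eq_iff)
    then show ?thesis
      using step.IH by auto
  qed
qed

subsection \<open>Acyclic graphs and bridges\<close>

text \<open>Turns reachability into a repetition-free list, the format of \<open>is_cycle\<close>.
  When a step leads to a vertex already on the list, the list is cut off there.\<close>

lemma distinct_walk:
  assumes "(a, b) \<in> (adj_rel F)\<^sup>*"
  obtains xs where "xs \<noteq> []" "hd xs = a" "last xs = b" "distinct xs"
    "\<And>n. Suc n < length xs \<Longrightarrow> {xs ! n, xs ! Suc n} \<in> F"
proof -
  have "\<exists>xs. xs \<noteq> [] \<and> hd xs = a \<and> last xs = b \<and> distinct xs \<and>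
      (\<forall>n. Suc n < length xs \<longrightarrow> {xs ! n, xs ! Suc n} \<in> F)"
    using assms
  proof (induction rule: rtrancl_induct)
    case base
    show ?case by (rule exI[of _ "[a]"]) simp
  next
    case (step b c)
    then obtain xs where xs: "xs \<noteq> []" "hd xs = a" "last xs = b" "distinct xs"
      "\<And>n. Suc n < length xs \<Longrightarrow> {xs ! n, xs ! Suc n} \<in> F" by blast
    show ?case
    proof (cases "c \<in> set xs")
      case True
      then obtain m where m: "m < length xs" "xs ! m = c"
        by (auto simp: in_set_conv_nth)
      let ?ys = "take (Suc m) xs"
      have "last ?ys = c"
        using m by (simp add: take_Suc_conv_app_nth)
      then show ?thesis
        using xs m by (intro exI[of _ ?ys]) (auto simp: hd_conv_nth)
    next
      case False
      have "{(xs @ [c]) ! n, (xs @ [c]) ! Suc n} \<in> F" if "Suc n < length (xs @ [c])" for n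
      proof (cases "Suc n < length xs")
        case True
        then show ?thesis using xs(5) by (simp add: nth_append)
      next
        case False
        then have n: "n = length xs - 1" "Suc n = length xs"
          using that xs(1) by auto
        have "xs ! n = b"
          using xs(1,3) n(1) by (simp add: last_conv_nth)
        then show ?thesis
          using step.hyps(2) n(2) by (simp add: nth_append adj_rel_def)
      qed
      then show ?thesis
        using xs False by (intro exI[of _ "xs @ [c]"]) auto
    qed
  qed
  then show thesis using that by blast
qed

text \<open>On a cycle, the edge joining the last vertex to the first is bypassed by the rest of the
  cycle, so a graph all of whose edges are bridges has no cycle.\<close>

lemma acyclic_graphI:
  assumes "\<And>a b. {a, b} \<in> F \<Longrightarrow> a \<noteq> b \<Longrightarrow> (a, b) \<notin> (adj_rel (F - {{a, b}}))\<^sup>*"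
  shows "acyclic_graph F"
  unfolding acyclic_graph_def
proof (intro notI, elim exE)
  fix xs assume "is_cycle F xs"
  then have xs: "3 \<le> length xs" "distinct xs"
    "\<And>n. n < length xs \<Longrightarrow> {xs ! n, xs ! (Suc n mod length xs)} \<in> F"
    by (auto simp: is_cycle_def)
  let ?l = "length xs - 1"
  let ?G = "F - {{xs ! 0, xs ! ?l}}"
  have walk: "n \<le> ?l \<Longrightarrow> (xs ! 0, xs ! n) \<in> (adj_rel ?G)\<^sup>*" for n
  proof (induction n)
    case (Suc n)
    then have n: "Suc n < length xs" using xs(1) by linarith
    have "xs \<noteq> []" using n by auto
    have inj: "p = q" if "p < length xs" "q < length xs" "xs ! p = xs ! q" for p q
      using that xs(2) by (simp add: nth_eq_iff_index_eq)
    have "xs ! n \<noteq> xs ! ?l" "xs ! Suc n \<noteq> xs ! 0"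
      using n xs(1) inj[of n ?l] inj[of "Suc n" 0] \<open>xs \<noteq> []\<close> by auto
    \<comment> \<open>Distinctness forces \<open>n\<close> to be 0 here, and length at least 3 keeps
      index 1 apart from the last index.\<close>
    moreover have "xs ! Suc n \<noteq> xs ! ?l" if "xs ! n = xs ! 0"
      using n xs(1) inj[of n 0] inj[of "Suc n" ?l] that \<open>xs \<noteq> []\<close> by auto
    ultimately have "{xs ! n, xs ! Suc n} \<noteq> {xs ! 0, xs ! ?l}"
      by (auto simp: doubleton_eq_iff)
    moreover have "{xs ! n, xs ! Suc n} \<in> F"
      using xs(3)[of n] n by simp
    ultimately have "(xs ! n, xs ! Suc n) \<in> adj_rel ?G"
      by (auto simp: adj_rel_def)
    with Suc show ?case by (simp add: rtrancl_into_rtrancl)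
  qed simp
  have "{xs ! ?l, xs ! 0} \<in> F"
    using xs(3)[of ?l] xs(1) by (metis One_nat_def Suc_pred diff_less gr_zeroI
      less_numeral_extra(1) mod_self not_numeral_le_zero order_less_le_trans)
  then have "{xs ! 0, xs ! ?l} \<in> F" by (simp add: insert_commute)
  moreover have "xs ! 0 \<noteq> xs ! ?l"
  proof
    assume "xs ! 0 = xs ! ?l"
    then have "0 = ?l" using xs(1,2) by (subst (asm) nth_eq_iff_index_eq) auto
    then show False using xs(1) by simp
  qed
  ultimately show False using assms walk by blast
qed

text \<open>Converse of \<open>acyclic_graphI\<close>: a repetition-free bypass of the edge, closed
  up by the edge itself, would be a cycle.\<close>

lemma acyclic_graph_bridge:
  assumes "acyclic_graph F" "{a, b} \<in> F" "a \<noteq> b"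
  shows "(a, b) \<notin> (adj_rel (F - {{a, b}}))\<^sup>*"
proof
  assume "(a, b) \<in> (adj_rel (F - {{a, b}}))\<^sup>*"
  then obtain xs where xs: "xs \<noteq> []" "hd xs = a" "last xs = b" "distinct xs"
    "\<And>n. Suc n < length xs \<Longrightarrow> {xs ! n, xs ! Suc n} \<in> F - {{a, b}}"
    by (rule distinct_walk) blast
  have ends: "xs ! 0 = a" "xs ! (length xs - 1) = b"
    using xs by (auto simp: hd_conv_nth last_conv_nth)
  \<comment> \<open>A bypass with one vertex would force \<open>a = b\<close>; one with two vertices
    would traverse the deleted edge. Hence three vertices, as \<open>is_cycle\<close>
    demands.\<close>
  have "length xs \<noteq> 1" using ends \<open>a \<noteq> b\<close> by auto
  moreover have "length xs \<noteq> 2" using ends xs(5)[of 0] by auto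
  ultimately have len: "3 \<le> length xs"
    using xs(1) by (cases "length xs") auto
  have "{xs ! n, xs ! (Suc n mod length xs)} \<in> F" if "n < length xs" for n
  proof (cases "Suc n < length xs")
    case True
    then show ?thesis using xs(5) by simp
  next
    case False
    then have "Suc n = length xs" "n = length xs - 1" using that by auto
    then show ?thesis using ends assms(2) by (simp add: insert_commute)
  qed
  then have "is_cycle F xs" using len xs(4) by (simp add: is_cycle_def)
  then show False using assms(1) by (auto simp: acyclic_graph_def)
qed

lemma acyclic_graph_subset: "acyclic_graph F \<Longrightarrow> G \<subseteq> F \<Longrightarrow> acyclic_graph G"
  by (auto simp: acyclic_graph_def is_cycle_def)

text \<open>By the bridge criterion. The new edge is a bridge by assumption. An old edge could only
  be bypassed through the new one, and then the two halves of the bypass, joined by the old edge,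
  would connect \<open>i\<close> to \<open>k\<close> inside \<open>F\<close>.\<close>

lemma acyclic_graph_insert:
  assumes "acyclic_graph F" "(i, k) \<notin> (adj_rel F)\<^sup>*"
  shows "acyclic_graph (insert {i, k} F)"
proof (rule acyclic_graphI)
  fix a b assume ab: "{a, b} \<in> insert {i, k} F" "a \<noteq> b"
  have nF: "{i, k} \<notin> F" using assms(2) adj_rel_edge[of i k F] by blast
  show "(a, b) \<notin> (adj_rel (insert {i, k} F - {{a, b}}))\<^sup>*"
  proof (cases "{a, b} = {i, k}")
    case True
    then have eq: "insert {i, k} F - {{a, b}} = F" using nF by auto
    have "(k, i) \<notin> (adj_rel F)\<^sup>*" using assms(2) sym_adj_rel_rtrancl[of k i F] by blast
    moreover have "a = i \<and> b = k \<or> a = k \<and> b = i" using True by (simp add: doubleton_eq_iff)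
    ultimately show ?thesis
      unfolding eq using assms(2) by (elim disjE conjE) simp_all
  next
    case False
    then have abF: "{a, b} \<in> F" using ab by auto
    let ?G = "F - {{a, b}}"
    have eq: "insert {i, k} F - {{a, b}} = insert {i, k} ?G" using False by auto
    have up: "(x, y) \<in> (adj_rel ?G)\<^sup>* \<Longrightarrow> (x, y) \<in> (adj_rel F)\<^sup>*" for x y
      by (rule adj_rel_rtrancl_mono) auto
    have conn: "(i, k) \<in> (adj_rel F)\<^sup>*"
      if "(a, i) \<in> (adj_rel ?G)\<^sup>* \<and> (k, b) \<in> (adj_rel ?G)\<^sup>*
        \<or> (a, k) \<in> (adj_rel ?G)\<^sup>* \<and> (i, b) \<in> (adj_rel ?G)\<^sup>*"
      using that
    proof (elim disjE conjE)
      assume "(a, i) \<in> (adj_rel ?G)\<^sup>*" "(k, b) \<in> (adj_rel ?G)\<^sup>*"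
      then have "(i, a) \<in> (adj_rel F)\<^sup>*" "(b, k) \<in> (adj_rel F)\<^sup>*"
        by (simp_all add: up sym_adj_rel_rtrancl)
      then show ?thesis
        using rtrancl_trans[OF rtrancl_trans[OF _ adj_rel_edge[OF abF]]] by blast
    next
      assume "(a, k) \<in> (adj_rel ?G)\<^sup>*" "(i, b) \<in> (adj_rel ?G)\<^sup>*"
      then have "(i, b) \<in> (adj_rel F)\<^sup>*" "(a, k) \<in> (adj_rel F)\<^sup>*"
        by (simp_all add: up)
      then show ?thesis
        using rtrancl_trans[OF rtrancl_trans[OF _ sym_adj_rel_rtrancl[OF adj_rel_edge[OF abF]]]]
        by blast
    qed
    show ?thesis
    proof
      assume "(a, b) \<in> (adj_rel (insert {i, k} F - {{a, b}}))\<^sup>*"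
      from adj_rel_rtrancl_insert[OF this[unfolded eq]] conn assms(2)
        acyclic_graph_bridge[OF assms(1) abF ab(2)] show False by blast
    qed
  qed
qed

text \<open>A connected edge set of least cardinality is acyclic, since an edge with a bypass could
  be deleted. This makes the later division by the number of spanning trees legitimate.\<close>

lemma spanning_tree_exists:
  assumes "finite E" "connected_graph V E"
  shows "spanning_trees V E \<noteq> {}"
proof -
  let ?P = "\<lambda>F. F \<subseteq> E \<and> connected_graph V F"
  obtain F where F: "?P F" and min: "\<And>G. ?P G \<Longrightarrow> card F \<le> card G"
    using ex_has_least_nat[of ?P E card] assms(2) by auto
  have "acyclic_graph F"
  proof (rule acyclic_graphI, rule notI)
    fix a b assume ab: "{a, b} \<in> F" "(a, b) \<in> (adj_rel (F - {{a, b}}))\<^sup>*"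
    let ?G = "F - {{a, b}}"
    have F_eq: "F = insert {a, b} ?G" using ab by auto
    have "(u, v) \<in> (adj_rel ?G)\<^sup>*" if "(u, v) \<in> (adj_rel F)\<^sup>*" for u v
    proof -
      note trans = rtrancl_trans[OF rtrancl_trans[OF _ ab(2)]]
        rtrancl_trans[OF rtrancl_trans[OF _ sym_adj_rel_rtrancl[OF ab(2)]]]
      have "(u, v) \<in> (adj_rel (insert {a, b} ?G))\<^sup>*"
        using that F_eq by simp
      from adj_rel_rtrancl_insert[OF this] show ?thesis
        by (blast intro: trans)
    qed
    then have "?P ?G" using F by (auto simp: connected_graph_def)
    then have "card F \<le> card ?G" by (rule min)
    moreover have "card ?G < card F"
      by (rule card_Diff1_less) (use F assms(1) ab in \<open>auto intro: finite_subset\<close>)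
    ultimately show False by simp
  qed
  then show ?thesis using F by (auto simp: spanning_trees_def)
qed

subsection \<open>Spanning trees and 2-forests\<close>

lemma component_of_eq_iff:
  assumes "u \<in> V" "v \<in> V"
  shows "component_of V F u = component_of V F v \<longleftrightarrow> (u, v) \<in> (adj_rel F)\<^sup>*"
proof
  assume "component_of V F u = component_of V F v"
  moreover have "v \<in> component_of V F v" using assms by (simp add: component_of_def)
  ultimately have "v \<in> component_of V F u" by simp
  then show "(u, v) \<in> (adj_rel F)\<^sup>*" by (simp add: component_of_def)
next
  assume "(u, v) \<in> (adj_rel F)\<^sup>*"
  then show "component_of V F u = component_of V F v"
    using rtrancl_trans[of u v "adj_rel F"] rtrancl_trans[of v u "adj_rel F"] sym_adj_rel_rtrancl[of u v F]
    by (auto simp: component_of_def)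
qed

lemma in_component_of_iff:
  assumes "u \<in> V" "v \<in> V"
  shows "v \<in> component_of V F u \<longleftrightarrow> component_of V F u = component_of V F v"
  using assms by (simp add: component_of_eq_iff) (simp add: component_of_def)

lemma components_of_two:
  assumes "u \<in> V" "v \<in> V" "card (components_of V F) = 2"
    and "component_of V F u \<noteq> component_of V F v"
  shows "component_of V F v = V - component_of V F u"
proof -
  have sub: "{component_of V F u, component_of V F v} \<subseteq> components_of V F"
    using assms by (auto simp: components_of_def)
  \<comment> \<open>An infinite set has \<open>card\<close> 0, so cardinality 2 already gives
    finiteness.\<close>
  have "finite (components_of V F)"
    by (rule card_ge_0_finite) (simp add: assms(3))
  then have "{component_of V F u, component_of V F v} = components_of V F"
    by (rule card_subset_eq[OF _ sub]) (simp add: assms(3,4))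
  then have w: "component_of V F w = component_of V F u \<or> component_of V F w = component_of V F v" if "w \<in> V" for w
    using that by (auto simp: components_of_def)
  have sV: "component_of V F v \<subseteq> V" by (auto simp: component_of_def)
  show ?thesis
  proof (rule set_eqI)
    fix x
    show "x \<in> component_of V F v \<longleftrightarrow> x \<in> V - component_of V F u"
    proof (cases "x \<in> V")
      case True
      then show ?thesis
        using w[OF True] in_component_of_iff[OF assms(1) True] in_component_of_iff[OF assms(2) True]
          assms(4) by auto
    qed (use sV in auto)
  qed
qed

lemma insert_edge_spanning_tree:
  assumes "F \<in> two_forests_separating V E i k" "{i, k} \<in> E" "i \<in> V" "k \<in> V"
  shows "insert {i, k} F \<in> spanning_trees V E"
proof -
  have F: "F \<subseteq> E" "acyclic_graph F" "card (components_of V F) = 2"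
      "component_of V F i \<noteq> component_of V F k"
    using assms(1) by (auto simp: two_forests_separating_def two_forests_def)
  let ?T = "insert {i, k} F"
  have "(i, k) \<notin> (adj_rel F)\<^sup>*" using F(4) assms by (simp add: component_of_eq_iff)
  then have "acyclic_graph ?T" using F by (intro acyclic_graph_insert)
  moreover have "(i, w) \<in> (adj_rel ?T)\<^sup>*" if "w \<in> V" for w
  proof -
    have "w \<in> component_of V F i \<or> w \<in> component_of V F k"
      using components_of_two[OF assms(3,4) F(3,4)] that by auto
    then have "(i, w) \<in> (adj_rel F)\<^sup>* \<or> (k, w) \<in> (adj_rel F)\<^sup>*"
      by (auto simp: component_of_def)
    moreover have "(i, k) \<in> (adj_rel ?T)\<^sup>*" by (rule adj_rel_edge) simp
    ultimately show ?thesis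
      using adj_rel_rtrancl_mono[of F ?T] rtrancl_trans[of i k "adj_rel ?T" w] by blast
  qed
  then have "connected_graph V ?T"
    using assms(3) rtrancl_trans[OF sym_adj_rel_rtrancl, of i _ ?T] by (auto simp: connected_graph_def)
  ultimately show ?thesis using F(1) assms(2) by (simp add: spanning_trees_def)
qed

lemma remove_edge_two_forest:
  assumes "T \<in> spanning_trees V E" "{i, k} \<in> T" "i \<noteq> k" "i \<in> V" "k \<in> V"
  shows "T - {{i, k}} \<in> two_forests_separating V E i k"
proof -
  let ?G = "T - {{i, k}}"
  have T: "T \<subseteq> E" "acyclic_graph T" "connected_graph V T"
    using assms(1) by (auto simp: spanning_trees_def)
  have ne: "component_of V ?G i \<noteq> component_of V ?G k"
    using acyclic_graph_bridge[OF T(2) assms(2,3)] assms by (simp add: component_of_eq_iff)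
  have "component_of V ?G w \<in> {component_of V ?G i, component_of V ?G k}" if "w \<in> V" for w
  proof -
    have "(i, w) \<in> (adj_rel (insert {i, k} ?G))\<^sup>*"
      using T(3) that assms by (simp add: connected_graph_def insert_absorb)
    then have "(i, w) \<in> (adj_rel ?G)\<^sup>* \<or> (k, w) \<in> (adj_rel ?G)\<^sup>*"
      by (blast dest: adj_rel_rtrancl_insert)
    then show ?thesis
      using that assms component_of_eq_iff[of i V w] component_of_eq_iff[of k V w] by auto
  qed
  then have "components_of V ?G = {component_of V ?G i, component_of V ?G k}"
    using assms by (auto simp: components_of_def)
  then have "card (components_of V ?G) = 2" using ne by simp
  then show ?thesis
    using T ne acyclic_graph_subset[OF T(2), of ?G]
    by (auto simp: two_forests_separating_def two_forests_def)
qed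

text \<open>Every tree edge is a bridge, so deleting it leaves exactly two components with its ends
  apart; putting it back rejoins them without a cycle. This turns sums over 2-forests into sums over
  spanning trees.\<close>

lemma two_forests_separating_bij_betw:
  assumes "{i, k} \<in> E" "i \<noteq> k" "i \<in> V" "k \<in> V"
  shows "bij_betw (\<lambda>T. T - {{i, k}}) {T \<in> spanning_trees V E. {i, k} \<in> T}
    (two_forests_separating V E i k)"
proof (rule bij_betwI[where g = "insert {i, k}"])
  have notin: "{i, k} \<notin> F" if "F \<in> two_forests_separating V E i k" for F
  proof
    assume "{i, k} \<in> F"
    then have "(i, k) \<in> (adj_rel F)\<^sup>*" by (rule adj_rel_edge)
    then show False
      using that assms by (simp add: two_forests_separating_def component_of_eq_iff)
  qed
  then show "insert {i, k} F - {{i, k}} = F" if "F \<in> two_forests_separating V E i k" for F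
    using that by auto
  show "(\<lambda>T. T - {{i, k}}) \<in> {T \<in> spanning_trees V E. {i, k} \<in> T} \<rightarrow> two_forests_separating V E i k"
    using assms remove_edge_two_forest by fastforce
  show "insert {i, k} \<in> two_forests_separating V E i k \<rightarrow> {T \<in> spanning_trees V E. {i, k} \<in> T}"
    using assms insert_edge_spanning_tree by fastforce
qed auto

text \<open>Follow a walk from \<open>i\<close>: each departure from \<open>i\<close> selects a new
  root \<open>k\<close>, and until the next visit to \<open>i\<close> no step can use the edge
  \<open>ik\<close>.\<close>

lemma spanning_tree_branch_exists:
  assumes "(i, v) \<in> (adj_rel T)\<^sup>*" "v \<noteq> i"
  shows "\<exists>k. {i, k} \<in> T \<and> (k, v) \<in> (adj_rel (T - {{i, k}}))\<^sup>*"
  using assms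
proof (induction rule: rtrancl_induct)
  case (step v w)
  show ?case
  proof (cases "v = i")
    case True
    then show ?thesis using step.hyps(2) by (auto simp: adj_rel_def)
  next
    case False
    with step.IH obtain k where k: "{i, k} \<in> T" "(k, v) \<in> (adj_rel (T - {{i, k}}))\<^sup>*"
      by blast
    have "(v, w) \<in> adj_rel (T - {{i, k}})"
      using step.hyps(2) step.prems False by (auto simp: adj_rel_def doubleton_eq_iff)
    with k(2) have "(k, w) \<in> (adj_rel (T - {{i, k}}))\<^sup>*" by (rule rtrancl_into_rtrancl)
    then show ?thesis using k(1) by blast
  qed
qed simp

text \<open>The walk from \<open>k'\<close> to \<open>v\<close> never meets \<open>i\<close>,
  because \<open>ik'\<close> is a bridge. It therefore survives deletion of \<open>ik\<close>, and
  the route from \<open>i\<close> through \<open>k'\<close> and \<open>v\<close> to \<open>k\<close>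
  would bypass the bridge \<open>ik\<close>.\<close>

lemma spanning_tree_branch_unique:
  assumes T: "acyclic_graph T" and k: "{i, k} \<in> T" "i \<noteq> k" and k': "{i, k'} \<in> T" "i \<noteq> k'"
    and v: "(k, v) \<in> (adj_rel (T - {{i, k}}))\<^sup>*"
    and v': "(k', v) \<in> (adj_rel (T - {{i, k'}}))\<^sup>*"
  shows "k = k'"
proof (rule ccontr)
  assume "k \<noteq> k'"
  let ?G = "T - {{i, k}}" and ?G' = "T - {{i, k'}}"
  have bridge': "(k', i) \<notin> (adj_rel ?G')\<^sup>*"
    using acyclic_graph_bridge[OF T k'] sym_adj_rel_rtrancl[of k' i ?G'] by blast
  have "(k', v) \<in> (adj_rel ?G)\<^sup>*"
    using v'
  proof (induction rule: rtrancl_induct)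
    case (step x y)
    have "(k', y) \<in> (adj_rel ?G')\<^sup>*" using step.hyps by (rule rtrancl_into_rtrancl)
    then have "x \<noteq> i" "y \<noteq> i" using step.hyps(1) bridge' by metis+
    then have "{x, y} \<noteq> {i, k}" by (simp add: doubleton_eq_iff)
    then have "(x, y) \<in> adj_rel ?G"
      using step.hyps(2) by (simp add: adj_rel_def)
    with step.IH show ?case by (rule rtrancl_into_rtrancl)
  qed simp
  moreover have "(i, k') \<in> (adj_rel ?G)\<^sup>*"
    by (rule adj_rel_edge) (use k' \<open>k \<noteq> k'\<close> in \<open>auto simp: doubleton_eq_iff\<close>)
  ultimately have "(i, v) \<in> (adj_rel ?G)\<^sup>*" by (rule rtrancl_trans[rotated])
  then have "(i, k) \<in> (adj_rel ?G)\<^sup>*"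
    using sym_adj_rel_rtrancl[OF v] by (rule rtrancl_trans)
  then show False using acyclic_graph_bridge[OF T k] by blast
qed

subsection \<open>The law of the first hitting time\<close>

text \<open>The projective limit has the finite iterations \<open>C\<close> of the kernels as
  marginals. Quantities depending on the first \<open>n\<close> positions can thus be computed in
  \<open>C\<close>, where single steps can be integrated out.\<close>

lemma srw_nn_integral_first_steps:
  fixes E :: "'a set set"
  assumes f: "f \<in> borel_measurable (PiM {0..<n} (\<lambda>_. count_space UNIV))"
  shows "(\<integral>\<^sup>+\<omega>. f (restrict \<omega> {0..<n}) \<partial>srw_measure E i) =
    (\<integral>\<^sup>+\<omega>. f \<omega> \<partial>Ionescu_Tulcea.C (srw_kernel E i) (\<lambda>_. count_space UNIV) 0 n (\<lambda>_. undefined))"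
proof -
  interpret Ionescu_Tulcea "srw_kernel E i" "\<lambda>_. count_space UNIV"
    by (rule srw_Ionescu_Tulcea)
  let ?M = "PiM {0..<n} (\<lambda>_. count_space (UNIV :: 'a set))"
  let ?J = "{0..<n}"
  have up: "up_to ?J = n"
    by (rule antisym) (auto simp: up_to_iff up_to_iff_Ico, use up_to[of ?J] in auto)
  have "(\<integral>\<^sup>+\<omega>. f (restrict \<omega> ?J) \<partial>srw_measure E i) =
      (\<integral>\<^sup>+\<omega>. f \<omega> \<partial>distr (srw_measure E i) ?M (\<lambda>\<omega>. restrict \<omega> ?J))"
    by (rule nn_integral_distr[symmetric])
       (auto simp: srw_measure_def f measurable_cong_sets[OF PF.sets_lim] simp del: restrict_apply
             intro!: measurable_restrict_subset)
  also have "distr (srw_measure E i) ?M (\<lambda>\<omega>. restrict \<omega> ?J) = CI ?J"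
    unfolding srw_measure_def by (rule distr_lim) simp
  also have "(\<integral>\<^sup>+\<omega>. f \<omega> \<partial>CI ?J) = (\<integral>\<^sup>+\<omega>. f (restrict \<omega> ?J) \<partial>C 0 n (\<lambda>_. undefined))"
    unfolding CI_def up
    by (rule nn_integral_distr)
       (auto simp: f measurable_cong_sets[OF sets_C] intro!: measurable_restrict measurable_component_singleton)
  also have "\<dots> = (\<integral>\<^sup>+\<omega>. f \<omega> \<partial>C 0 n (\<lambda>_. undefined))"
    by (intro nn_integral_cong) (auto simp: space_C space_PiM)
  finally show ?thesis .
qed

text \<open>The product form of the event that \<open>j\<close> is missed up to and including time
  \<open>t\<close> lets the factor of the last step be split off.\<close>

definition avoid_weight :: "'a \<Rightarrow> nat \<Rightarrow> (nat \<Rightarrow> 'a) \<Rightarrow> ennreal" where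
  "avoid_weight j t \<omega> = (\<Prod>s\<le>t. indicator (- {j}) (\<omega> s))"

lemma avoid_weight_eq: "avoid_weight j t \<omega> = (if enat t < first_hit j \<omega> then 1 else 0)"
proof -
  have "enat t < first_hit j \<omega> \<longleftrightarrow> (\<forall>s\<le>t. \<omega> s \<noteq> j)"
  proof
    assume *: "enat t < first_hit j \<omega>"
    show "\<forall>s\<le>t. \<omega> s \<noteq> j"
    proof (intro allI impI notI)
      fix s assume s: "s \<le> t" "\<omega> s = j"
      then have "first_hit j \<omega> \<le> enat s"
        unfolding first_hit_def by (intro Inf_lower) auto
      with * s show False
        by (metis enat_ord_simps(1) leD order_trans)
    qed
  next
    assume *: "\<forall>s\<le>t. \<omega> s \<noteq> j"
    have "enat (Suc t) \<le> first_hit j \<omega>"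
      unfolding first_hit_def
      by (rule Inf_greatest) (use * in \<open>auto simp: not_less_eq_eq\<close>)
    then show "enat t < first_hit j \<omega>"
      by (simp add: Suc_ile_eq)
  qed
  then show ?thesis
    by (auto simp: avoid_weight_def indicator_def)
qed

lemma measurable_avoid_weight:
  assumes "{..t} \<subseteq> I"
  shows "avoid_weight j t \<in> borel_measurable (PiM I (\<lambda>_. count_space UNIV))"
  unfolding avoid_weight_def
  by (intro borel_measurable_prod_ennreal measurable_compose[OF measurable_component_singleton])
     (use assms in auto)

lemma measurable_avoid_weight_times:
  assumes "{..t} \<subseteq> I" "s \<in> I"
  shows "(\<lambda>\<omega>. avoid_weight j t \<omega> * (\<phi> (\<omega> s) :: ennreal))
    \<in> borel_measurable (PiM I (\<lambda>_. count_space UNIV))"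
proof (rule borel_measurable_times_ennreal)
  show "avoid_weight j t \<in> borel_measurable (PiM I (\<lambda>_. count_space UNIV))"
    by (rule measurable_avoid_weight) fact
  show "(\<lambda>\<omega>. \<phi> (\<omega> s)) \<in> borel_measurable (PiM I (\<lambda>_. count_space UNIV))"
    by (rule measurable_compose[OF measurable_component_singleton]) (use assms in auto)
qed

lemma srw_avoid_0:
  "(\<integral>\<^sup>+\<omega>. avoid_weight j 0 \<omega> * \<phi> (\<omega> 0) \<partial>srw_measure E i) = indicator (- {j}) i * \<phi> i"
proof -
  interpret Ionescu_Tulcea "srw_kernel E i" "\<lambda>_. count_space UNIV"
    by (rule srw_Ionescu_Tulcea)
  let ?f = "\<lambda>\<omega>. avoid_weight j 0 \<omega> * \<phi> (\<omega> 0)"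
  have m: "?f \<in> borel_measurable (PiM {0..<Suc 0} (\<lambda>_. count_space UNIV))"
    by (rule measurable_avoid_weight_times) auto
  have "(\<integral>\<^sup>+\<omega>. ?f \<omega> \<partial>srw_measure E i) = (\<integral>\<^sup>+\<omega>. ?f (restrict \<omega> {0..<Suc 0}) \<partial>srw_measure E i)"
    by (simp add: avoid_weight_def)
  also have "\<dots> = (\<integral>\<^sup>+\<omega>. ?f \<omega> \<partial>C 0 (Suc 0) (\<lambda>_. undefined))"
    by (rule srw_nn_integral_first_steps) (rule m)
  also have "C 0 (Suc 0) (\<lambda>_. undefined) = eP 0 (\<lambda>_. undefined)"
    using bind_return[OF measurable_eP[of 0], of "\<lambda>_. undefined"] by (simp add: space_PiM)
  also have "(\<integral>\<^sup>+\<omega>. ?f \<omega> \<partial>eP 0 (\<lambda>_. undefined)) =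
      (\<integral>\<^sup>+x. ?f (fun_upd (\<lambda>_. undefined) 0 x) \<partial>srw_kernel E i 0 (\<lambda>_. undefined))"
    by (rule nn_integral_eP) (use m in \<open>auto simp: space_PiM\<close>)
  also have "\<dots> = indicator (- {j}) i * \<phi> i"
    by (simp add: srw_kernel_def avoid_weight_def)
  finally show ?thesis .
qed

text \<open>The Markov property: integrating out the last position replaces the test function
  \<open>\<phi>\<close> by its average over a step of the walk killed at \<open>j\<close>. Keeping
  an arbitrary test function allows iteration.\<close>

lemma srw_avoid_Suc:
  "(\<integral>\<^sup>+\<omega>. avoid_weight j (Suc t) \<omega> * \<phi> (\<omega> (Suc t)) \<partial>srw_measure E i) =
   (\<integral>\<^sup>+\<omega>. avoid_weight j t \<omega> *
      (\<integral>\<^sup>+w. indicator (- {j}) w * \<phi> w \<partial>pmf_of_set (neighbours E (\<omega> t))) \<partial>srw_measure E i)"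
proof -
  interpret Ionescu_Tulcea "srw_kernel E i" "\<lambda>_. count_space UNIV"
    by (rule srw_Ionescu_Tulcea)
  let ?f = "\<lambda>\<omega>. avoid_weight j (Suc t) \<omega> * \<phi> (\<omega> (Suc t))"
  let ?\<psi> = "\<lambda>v. \<integral>\<^sup>+w. indicator (- {j}) w * \<phi> w \<partial>pmf_of_set (neighbours E v)"
  let ?g = "\<lambda>\<omega>. avoid_weight j t \<omega> * ?\<psi> (\<omega> t)"
  have mf: "?f \<in> borel_measurable (PiM {0..<Suc (Suc t)} (\<lambda>_. count_space UNIV))"
    by (rule measurable_avoid_weight_times) auto
  have mg: "?g \<in> borel_measurable (PiM {0..<Suc t} (\<lambda>_. count_space UNIV))"
    by (rule measurable_avoid_weight_times) auto
  have "(\<integral>\<^sup>+\<omega>. ?f \<omega> \<partial>srw_measure E i) =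
      (\<integral>\<^sup>+\<omega>. ?f (restrict \<omega> {0..<Suc (Suc t)}) \<partial>srw_measure E i)"
    by (simp add: avoid_weight_def)
  also have "\<dots> = (\<integral>\<^sup>+\<omega>. ?f \<omega> \<partial>C 0 (Suc (Suc t)) (\<lambda>_. undefined))"
    by (rule srw_nn_integral_first_steps) (rule mf)
  \<comment> \<open>The last position is drawn from \<open>eP\<close> given the earlier ones, so the
    integral becomes an iterated one.\<close>
  also have "\<dots> = (\<integral>\<^sup>+\<omega>. (\<integral>\<^sup>+\<omega>'. ?f \<omega>' \<partial>eP (Suc t) \<omega>) \<partial>C 0 (Suc t) (\<lambda>_. undefined))"
    unfolding C.simps(2)[of 0 "Suc t"] add_0
    by (rule nn_integral_bind[OF mf])
       (use measurable_eP[of "Suc t"] in \<open>simp add: measurable_cong_sets[OF sets_C] del: C.simps\<close>)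
  also have "\<dots> = (\<integral>\<^sup>+\<omega>. ?g \<omega> \<partial>C 0 (Suc t) (\<lambda>_. undefined))"
  proof (rule nn_integral_cong)
    fix \<omega> assume "\<omega> \<in> space (C 0 (Suc t) (\<lambda>_. undefined))"
    then have \<omega>: "\<omega> \<in> space (PiM {0..<Suc t} (\<lambda>_. count_space UNIV))"
      by (subst (asm) space_C) (simp_all add: space_PiM)
    have "(\<integral>\<^sup>+\<omega>'. ?f \<omega>' \<partial>eP (Suc t) \<omega>) =
        (\<integral>\<^sup>+w. ?f (fun_upd \<omega> (Suc t) w) \<partial>srw_kernel E i (Suc t) \<omega>)"
      by (rule nn_integral_eP[OF \<omega> mf])
    also have "\<dots> = ?g \<omega>"
      by (simp add: srw_kernel_def avoid_weight_def mult.assoc nn_integral_cmult)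
    finally show "(\<integral>\<^sup>+\<omega>'. ?f \<omega>' \<partial>eP (Suc t) \<omega>) = ?g \<omega>" .
  qed
  also have "\<dots> = (\<integral>\<^sup>+\<omega>. ?g (restrict \<omega> {0..<Suc t}) \<partial>srw_measure E i)"
    by (rule srw_nn_integral_first_steps[symmetric]) (rule mg)
  also have "\<dots> = (\<integral>\<^sup>+\<omega>. ?g \<omega> \<partial>srw_measure E i)"
    by (simp add: avoid_weight_def)
  finally show ?thesis .
qed

text \<open>The probability that the walk from \<open>v\<close> misses \<open>j\<close> up to time
  \<open>t\<close>, as \<open>srw_avoid_weight\<close> confirms. The recursion is on the first step,
  as first-step equations require, whereas the path measure is decomposed at the last step.\<close>

primrec avoid_prob :: "'a set set \<Rightarrow> 'a \<Rightarrow> nat \<Rightarrow> 'a \<Rightarrow> ennreal" where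
  "avoid_prob E j 0 v = indicator (- {j}) v"
| "avoid_prob E j (Suc t) v =
     indicator (- {j}) v * (\<integral>\<^sup>+w. avoid_prob E j t w \<partial>pmf_of_set (neighbours E v))"

lemma indicator_times_avoid_prob: "indicator (- {j}) v * avoid_prob E j t v = avoid_prob E j t v"
  by (cases t) (auto simp: indicator_def)

text \<open>Reconciles the two directions: each induction step moves one unit of time from the path
  measure into the recursion, which is why \<open>s\<close> is kept arbitrary.\<close>

lemma srw_avoid_avoid_prob:
  "(\<integral>\<^sup>+\<omega>. avoid_weight j t \<omega> * avoid_prob E j s (\<omega> t) \<partial>srw_measure E i) = avoid_prob E j (t + s) i"
proof (induction t arbitrary: s)
  case 0
  show ?case by (simp add: srw_avoid_0 indicator_times_avoid_prob)
next
  case (Suc t)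
  \<comment> \<open>The weight vanishes if the walk is at \<open>j\<close> at time \<open>t\<close>,
    so the leading indicator of \<open>avoid_prob\<close> at \<open>Suc s\<close> can be supplied
    for free.\<close>
  have *: "avoid_weight j t \<omega> * (\<integral>\<^sup>+w. avoid_prob E j s w \<partial>pmf_of_set (neighbours E (\<omega> t))) =
      avoid_weight j t \<omega> * avoid_prob E j (Suc s) (\<omega> t)" for \<omega>
    by (cases "\<omega> t = j") (auto simp: avoid_weight_def indicator_def)
  show ?case
    by (simp only: srw_avoid_Suc indicator_times_avoid_prob * Suc.IH) simp
qed

lemma srw_avoid_weight: "(\<integral>\<^sup>+\<omega>. avoid_weight j t \<omega> \<partial>srw_measure E i) = avoid_prob E j t i"
proof -
  have "avoid_weight j t \<omega> = avoid_weight j t \<omega> * avoid_prob E j 0 (\<omega> t)" for \<omega>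
    by (auto simp: avoid_weight_def indicator_def)
  then have "(\<integral>\<^sup>+\<omega>. avoid_weight j t \<omega> \<partial>srw_measure E i) =
      (\<integral>\<^sup>+\<omega>. avoid_weight j t \<omega> * avoid_prob E j 0 (\<omega> t) \<partial>srw_measure E i)"
    by presburger
  also have "\<dots> = avoid_prob E j t i"
    using srw_avoid_avoid_prob[where s = 0] by simp
  finally show ?thesis .
qed

lemma ennreal_of_enat_conv_suminf:
  "ennreal_of_enat n = (\<Sum>t. if enat t < n then 1 else 0)"
proof -
  have "ennreal_of_enat n = (\<integral>\<^sup>+x. ennreal_of_enat n \<partial>count_space {0::nat})"
    by (simp add: nn_integral_count_space_finite)
  also have "\<dots> = (\<Sum>t. emeasure (count_space {0::nat}) {x \<in> space (count_space {0::nat}). enat t < n})"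
    by (rule nn_integral_enat_function) simp
  also have "\<dots> = (\<Sum>t. if enat t < n then 1 else 0)"
    by (intro suminf_cong) (simp add: Collect_conv_if)
  finally show ?thesis .
qed

text \<open>The tail-sum formula for an expectation, with sum and integral exchanged by
  nonnegativity; infinite hitting times are included. The path measure is left behind from here
  on.\<close>

lemma hitting_time_eq_suminf: "hitting_time E i j = (\<Sum>t. avoid_prob E j t i)"
proof -
  interpret Ionescu_Tulcea "srw_kernel E i" "\<lambda>_. count_space UNIV"
    by (rule srw_Ionescu_Tulcea)
  have m: "avoid_weight j t \<in> borel_measurable (srw_measure E i)" for t
    using measurable_avoid_weight[of t UNIV j]
    by (simp add: srw_measure_def measurable_cong_sets[OF PF.sets_lim])
  have "hitting_time E i j = (\<integral>\<^sup>+\<omega>. (\<Sum>t. avoid_weight j t \<omega>) \<partial>srw_measure E i)"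
    by (simp add: hitting_time_def ennreal_of_enat_conv_suminf avoid_weight_eq)
  also have "\<dots> = (\<Sum>t. \<integral>\<^sup>+\<omega>. avoid_weight j t \<omega> \<partial>srw_measure E i)"
    by (rule nn_integral_suminf) (rule m)
  finally show ?thesis by (simp add: srw_avoid_weight)
qed

subsection \<open>The forest weights and their Laplacian\<close>

text \<open>This is \<open>W\<^sub>j(i)\<close>. The target \<open>j\<close> comes first so that
  \<open>forest_vol V E j\<close> is a function of the starting vertex.\<close>

definition forest_vol :: "'a set \<Rightarrow> 'a set set \<Rightarrow> 'a \<Rightarrow> 'a \<Rightarrow> real" where
  "forest_vol V E j i = (\<Sum>F\<in>two_forests_separating V E i j. real (vol E (component_of V F i)))"

lemma forest_vol_nonneg: "0 \<le> forest_vol V E j i"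
  by (simp add: forest_vol_def sum_nonneg)

lemma forest_vol_self: "forest_vol V E j j = 0"
  by (simp add: forest_vol_def two_forests_separating_def)

section \<open>Degrees and the maximum principle on a connected graph\<close>

locale nontrivial_connected_graph =
  fixes V :: "'a set" and E :: "'a set set"
  assumes simple: "simple_graph V E"
    and conn: "connected_graph V E"
    and card_V: "2 \<le> card V"
begin

lemma finite_V: "finite V"
  using simple by (simp add: simple_graph_def)

lemma finite_E: "finite E"
proof (rule finite_subset)
  show "E \<subseteq> Pow V" using simple by (auto simp: simple_graph_def)
qed (simp add: finite_V)

lemma edgeD:
  assumes "{u, v} \<in> E"
  shows "u \<in> V" "v \<in> V" "u \<noteq> v"
proof -
  have "{u, v} \<subseteq> V" "card {u, v} = 2" using assms simple by (auto simp: simple_graph_def)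
  then show "u \<in> V" "v \<in> V" "u \<noteq> v" by auto
qed

lemma neighbours_subset: "neighbours E v \<subseteq> V"
  using edgeD(2) by (auto simp: neighbours_def)

lemma finite_neighbours: "finite (neighbours E v)"
  using neighbours_subset finite_V by (rule finite_subset)

lemma deg_pos:
  assumes "v \<in> V"
  shows "0 < deg E v"
proof -
  have "V \<noteq> {v}" using card_V by auto
  then obtain w where w: "w \<in> V" "w \<noteq> v" using assms by blast
  then have "(v, w) \<in> (adj_rel E)\<^sup>*" using conn assms by (simp add: connected_graph_def)
  then obtain y where "(v, y) \<in> adj_rel E"
    using w(2) by (metis converse_rtranclE)
  then have "neighbours E v \<noteq> {}" by (auto simp: neighbours_def adj_rel_def)
  then show ?thesis using finite_neighbours by (simp add: deg_def card_gt_0_iff)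
qed

lemma card_neighbours_pos: "v \<in> V \<Longrightarrow> 0 < card (neighbours E v)"
  using deg_pos by (simp add: deg_def)

text \<open>At a maximum other than \<open>j\<close> the differences to the neighbours are
  nonnegative with sum 0, so every neighbour is a maximum too. By connectivity the maximum spreads
  until it reaches \<open>j\<close>.\<close>

lemma discrete_maximum_principle:
  fixes g :: "'a \<Rightarrow> real"
  assumes j: "j \<in> V" and v: "v \<in> V"
    and harmonic: "\<And>i. i \<in> V \<Longrightarrow> i \<noteq> j \<Longrightarrow> (\<Sum>k\<in>neighbours E i. g i - g k) = 0"
  shows "g v \<le> g j"
proof -
  define M where "M = Max (g ` V)"
  have le: "g w \<le> M" if "w \<in> V" for w
    using that finite_V by (simp add: M_def)
  have "M \<in> g ` V" unfolding M_def using finite_V j by (intro Max_in) auto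
  then obtain z where z: "z \<in> V" "g z = M" by auto
  \<comment> \<open>The second alternative absorbs walks that pass through \<open>j\<close>, where
    harmonicity is not assumed.\<close>
  have "g w = M \<or> g j = M" if "(z, w) \<in> (adj_rel E)\<^sup>*" for w
    using that
  proof (induction rule: rtrancl_induct)
    case base
    show ?case using z by simp
  next
    case (step u w)
    have uw: "{u, w} \<in> E" using step.hyps(2) by (simp add: adj_rel_def)
    show ?case
    proof (cases "g j = M")
      case False
      then have u: "g u = M" "u \<noteq> j" using step.IH by auto
      have nonneg: "0 \<le> g u - g k" if "k \<in> neighbours E u" for k
        using that neighbours_subset le u(1) by (simp add: subset_iff)
      have "\<forall>k\<in>neighbours E u. g u - g k = 0"
        using harmonic[OF edgeD(1)[OF uw] u(2)]
        by (subst (asm) sum_nonneg_eq_0_iff[OF finite_neighbours nonneg]) simp_all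
      moreover have "w \<in> neighbours E u" using uw by (simp add: neighbours_def)
      ultimately show ?thesis using u(1) by simp
    qed simp
  qed
  moreover have "(z, j) \<in> (adj_rel E)\<^sup>*" using conn z j by (simp add: connected_graph_def)
  ultimately have "g j = M" by blast
  then show ?thesis using le v by simp
qed

section \<open>Branch sums and the Laplacian of the forest weights\<close>

lemma spanning_trees_nonempty: "spanning_trees V E \<noteq> {}"
  using finite_E conn by (rule spanning_tree_exists)

lemma finite_spanning_trees: "finite (spanning_trees V E)"
  by (rule finite_subset[of _ "Pow E"]) (auto simp: spanning_trees_def finite_E)

lemma finite_two_forests: "finite (two_forests V E)"
  by (rule finite_subset[of _ "Pow E"]) (auto simp: two_forests_def finite_E)

lemma spanning_tree_branch_sum:
  fixes x :: "'a \<Rightarrow> real"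
  assumes T: "T \<in> spanning_trees V E" and i: "i \<in> V"
  shows "(\<Sum>k\<in>neighbours T i. sum x (component_of V (T - {{i, k}}) k)) = sum x (V - {i})"
proof -
  let ?B = "\<lambda>k. component_of V (T - {{i, k}}) k"
  have T': "T \<subseteq> E" "acyclic_graph T" "connected_graph V T"
    using T by (auto simp: spanning_trees_def)
  have edge: "{i, k} \<in> T" "i \<noteq> k" if "k \<in> neighbours T i" for k
    using that T'(1) edgeD(3)[of i k] by (auto simp: neighbours_def)
  have fin: "finite (neighbours T i)"
    by (rule finite_subset[OF _ finite_neighbours[of i]]) (use T'(1) in \<open>auto simp: neighbours_def\<close>)
  have finB: "finite (?B k)" for k
    by (rule finite_subset[OF _ finite_V]) (auto simp: component_of_def)
  have disj: "?B k \<inter> ?B k' = {}" if "k \<in> neighbours T i" "k' \<in> neighbours T i" "k \<noteq> k'" for k k'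
  proof (rule equals0I)
    fix v assume "v \<in> ?B k \<inter> ?B k'"
    then have "(k, v) \<in> (adj_rel (T - {{i, k}}))\<^sup>*" "(k', v) \<in> (adj_rel (T - {{i, k'}}))\<^sup>*"
      by (auto simp: component_of_def)
    from spanning_tree_branch_unique[OF T'(2) edge[OF that(1)] edge[OF that(2)] this]
    show False using that(3) by simp
  qed
  have "(\<Union>k\<in>neighbours T i. ?B k) = V - {i}"
  proof (rule set_eqI)
    fix v
    show "v \<in> (\<Union>k\<in>neighbours T i. ?B k) \<longleftrightarrow> v \<in> V - {i}"
    proof
      assume "v \<in> (\<Union>k\<in>neighbours T i. ?B k)"
      then obtain k where k: "k \<in> neighbours T i" "v \<in> V" "(k, v) \<in> (adj_rel (T - {{i, k}}))\<^sup>*"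
        by (auto simp: component_of_def)
      have "(k, i) \<notin> (adj_rel (T - {{i, k}}))\<^sup>*"
        using acyclic_graph_bridge[OF T'(2) edge[OF k(1)]]
          sym_adj_rel_rtrancl[of k i "T - {{i, k}}"] by blast
      then have "v \<noteq> i" using k(3) by metis
      then show "v \<in> V - {i}" using k(2) by simp
    next
      assume v: "v \<in> V - {i}"
      then have "(i, v) \<in> (adj_rel T)\<^sup>*" "v \<noteq> i"
        using T'(3) i by (simp_all add: connected_graph_def)
      from spanning_tree_branch_exists[OF this] v
      show "v \<in> (\<Union>k\<in>neighbours T i. ?B k)"
        by (simp add: neighbours_def component_of_def)
    qed
  qed
  moreover have "sum x (\<Union>k\<in>neighbours T i. ?B k) = (\<Sum>k\<in>neighbours T i. sum x (?B k))"
    by (rule sum.UNION_disjoint) (use fin finB disj in auto)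
  ultimately show ?thesis by simp
qed

text \<open>Forests keeping \<open>i\<close> and \<open>k\<close> together cancel. In any other,
  \<open>j\<close> lies in exactly one tree: if in that of \<open>k\<close>, the difference is the
  volume of the tree of \<open>i\<close>, that is vol(V) minus the volume of the tree of
  \<open>k\<close>; otherwise it is minus the latter volume. Both cases are one sum of a fixed
  vertex function over the tree of \<open>k\<close>, so branches can later be added up.\<close>

lemma forest_vol_diff:
  assumes ik: "{i, k} \<in> E" and j: "j \<in> V"
  shows "forest_vol V E j i - forest_vol V E j k =
    (\<Sum>T\<in>{T \<in> spanning_trees V E. {i, k} \<in> T}.
      (\<Sum>v\<in>component_of V (T - {{i, k}}) k. (if v = j then real (vol E V) else 0) - real (deg E v)))"
proof -
  have i: "i \<in> V" and k: "k \<in> V" and ne: "i \<noteq> k" using edgeD[OF ik] by auto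
  let ?c = "component_of V"
  let ?g = "\<lambda>v F. if ?c F v \<noteq> ?c F j then real (vol E (?c F v)) else 0"
  have W: "forest_vol V E j v = (\<Sum>F\<in>two_forests V E. ?g v F)" for v
    unfolding forest_vol_def two_forests_separating_def
    by (rule sum.inter_filter) (rule finite_two_forests)
  have finc: "finite (?c F v)" for F v
    by (rule finite_subset[OF _ finite_V]) (auto simp: component_of_def)
  have "forest_vol V E j i - forest_vol V E j k = (\<Sum>F\<in>two_forests V E. ?g i F - ?g k F)"
    by (simp add: W sum_subtractf)
  also have "\<dots> = (\<Sum>F\<in>two_forests_separating V E i k. ?g i F - ?g k F)"
    by (rule sum.mono_neutral_right[OF finite_two_forests]) (auto simp: two_forests_separating_def)
  also have "\<dots> = (\<Sum>F\<in>two_forests_separating V E i k.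
      (\<Sum>v\<in>?c F k. (if v = j then real (vol E V) else 0) - real (deg E v)))"
  proof (rule sum.cong[OF refl])
    fix F assume "F \<in> two_forests_separating V E i k"
    then have two: "card (components_of V F) = 2" and sep: "?c F i \<noteq> ?c F k"
      by (auto simp: two_forests_separating_def two_forests_def)
    have ck: "?c F k = V - ?c F i" using i k two sep by (rule components_of_two)
    have sub: "?c F i \<subseteq> V" by (auto simp: component_of_def)
    have vol: "real (vol E V) = real (vol E (?c F i)) + real (vol E (?c F k))"
      using sum.subset_diff[OF sub finite_V, of "deg E"] by (simp add: vol_def ck)
    have ji: "j \<in> ?c F i \<longleftrightarrow> ?c F i = ?c F j" and jk: "j \<in> ?c F k \<longleftrightarrow> ?c F k = ?c F j"
      using in_component_of_iff i j k by metis+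
    have ex: "j \<in> ?c F i \<longleftrightarrow> j \<notin> ?c F k" using ck j by auto
    have "(\<Sum>v\<in>?c F k. (if v = j then real (vol E V) else 0) - real (deg E v)) =
        (if j \<in> ?c F k then real (vol E V) else 0) - real (vol E (?c F k))"
      by (simp add: sum_subtractf finc vol_def)
    then show "?g i F - ?g k F =
        (\<Sum>v\<in>?c F k. (if v = j then real (vol E V) else 0) - real (deg E v))"
      unfolding ji[symmetric] jk[symmetric] using ex vol by auto
  qed
  also have "\<dots> = (\<Sum>T\<in>{T \<in> spanning_trees V E. {i, k} \<in> T}.
      (\<Sum>v\<in>?c (T - {{i, k}}) k. (if v = j then real (vol E V) else 0) - real (deg E v)))"
    by (rule sum.reindex_bij_betw[OF two_forests_separating_bij_betw[OF ik ne i k], symmetric])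
  finally show ?thesis .
qed

text \<open>Exchanging the sums fixes a spanning tree first, and its branches at \<open>i\<close>
  then fill \<open>V - {i}\<close>. Since \<open>?x\<close> has total 0 on \<open>V\<close>, what
  remains is minus its value at \<open>i\<close>.\<close>

lemma forest_vol_laplacian:
  assumes i: "i \<in> V" and j: "j \<in> V"
  shows "(\<Sum>k\<in>neighbours E i. forest_vol V E j i - forest_vol V E j k) =
    real (card (spanning_trees V E)) * (real (deg E i) - (if i = j then real (vol E V) else 0))"
proof -
  let ?x = "\<lambda>v. (if v = j then real (vol E V) else 0) - real (deg E v)"
  let ?B = "\<lambda>T k. component_of V (T - {{i, k}}) k"
  have "(\<Sum>k\<in>neighbours E i. forest_vol V E j i - forest_vol V E j k) =
      (\<Sum>k\<in>neighbours E i. \<Sum>T\<in>{T \<in> spanning_trees V E. {i, k} \<in> T}. sum ?x (?B T k))"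
    by (rule sum.cong[OF refl]) (rule forest_vol_diff, simp_all add: neighbours_def j)
  also have "\<dots> = (\<Sum>T\<in>spanning_trees V E. \<Sum>k\<in>{k \<in> neighbours E i. {i, k} \<in> T}. sum ?x (?B T k))"
    by (rule sum.swap_restrict) (rule finite_neighbours, rule finite_spanning_trees)
  also have "\<dots> = (\<Sum>T\<in>spanning_trees V E. sum ?x (V - {i}))"
  proof (rule sum.cong[OF refl])
    fix T assume T: "T \<in> spanning_trees V E"
    then have "{k \<in> neighbours E i. {i, k} \<in> T} = neighbours T i"
      by (auto simp: neighbours_def spanning_trees_def)
    then show "(\<Sum>k\<in>{k \<in> neighbours E i. {i, k} \<in> T}. sum ?x (?B T k)) = sum ?x (V - {i})"
      using spanning_tree_branch_sum[OF T i] by simp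
  qed
  also have "sum ?x (V - {i}) = real (deg E i) - (if i = j then real (vol E V) else 0)"
  proof -
    have "sum ?x V = 0"
      using finite_V j by (simp add: sum_subtractf vol_def)
    then show ?thesis
      using sum.remove[OF finite_V i, of ?x] by (simp split: if_splits)
  qed
  finally show ?thesis by simp
qed

subsection \<open>Hitting times and the Kemeny constant\<close>

lemma nn_integral_neighbour:
  "v \<in> V \<Longrightarrow> (\<integral>\<^sup>+w. f w \<partial>pmf_of_set (neighbours E v)) =
    (\<Sum>k\<in>neighbours E v. f k) * inverse (ennreal (deg E v))"
  using card_neighbours_pos[of v] finite_neighbours[of v]
  by (subst nn_integral_pmf_of_set)
     (auto simp: deg_def divide_ennreal_def ennreal_of_nat_eq_real_of_nat)

lemma avoid_prob_self: "avoid_prob E j t j = 0"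
  by (cases t) auto

lemma hitting_time_self: "hitting_time E j j = 0"
  by (simp add: hitting_time_eq_suminf avoid_prob_self)

lemma avoid_prob_Suc:
  assumes "i \<in> V" "i \<noteq> j"
  shows "avoid_prob E j (Suc t) i =
    (\<Sum>k\<in>neighbours E i. avoid_prob E j t k) * inverse (ennreal (deg E i))"
  using assms by (simp add: nn_integral_neighbour)

text \<open>The summand for \<open>t = 0\<close> is 1 because \<open>i\<close> differs from
  \<open>j\<close>; the others shift by one step. Working in \<open>ennreal\<close>, this needs no
  finiteness.\<close>

lemma hitting_time_step:
  assumes i: "i \<in> V" "i \<noteq> j"
  shows "hitting_time E i j = 1 + (\<Sum>k\<in>neighbours E i. hitting_time E k j) * inverse (ennreal (deg E i))"
proof -
  have "(\<lambda>t. avoid_prob E j t i) sums ((\<Sum>t. avoid_prob E j (Suc t) i) + avoid_prob E j 0 i)"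
    by (intro sums_Suc summable_sums summableI)
  from sums_unique[OF this]
  have "hitting_time E i j = (\<Sum>t. avoid_prob E j (Suc t) i) + 1"
    using i(2) by (simp add: hitting_time_eq_suminf del: avoid_prob.simps(2))
  also have "(\<Sum>t. avoid_prob E j (Suc t) i) =
      (\<Sum>t. \<Sum>k\<in>neighbours E i. avoid_prob E j t k) * inverse (ennreal (deg E i))"
    unfolding avoid_prob_Suc[OF i] by (rule ennreal_suminf_multc)
  also have "(\<Sum>t. \<Sum>k\<in>neighbours E i. avoid_prob E j t k) =
      (\<Sum>k\<in>neighbours E i. hitting_time E k j)"
    unfolding hitting_time_eq_suminf by (rule suminf_sum) (rule summableI)
  finally show ?thesis by (simp add: add.commute)
qed

lemma ennreal_first_step:
  assumes i: "i \<in> V" and h: "\<And>v. v \<in> V \<Longrightarrow> 0 \<le> h v"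
  shows "1 + (\<Sum>k\<in>neighbours E i. ennreal (h k)) * inverse (ennreal (deg E i)) =
    ennreal (1 + (\<Sum>k\<in>neighbours E i. h k) / real (deg E i))"
proof -
  have h': "0 \<le> h k" if "k \<in> neighbours E i" for k
    using that h neighbours_subset by blast
  have d: "0 < real (deg E i)" using deg_pos[OF i] by simp
  have s: "0 \<le> (\<Sum>k\<in>neighbours E i. h k)" by (rule sum_nonneg) (rule h')
  have "(\<Sum>k\<in>neighbours E i. ennreal (h k)) * inverse (ennreal (deg E i)) =
      ennreal (\<Sum>k\<in>neighbours E i. h k) * ennreal (inverse (real (deg E i)))"
    using d h' by (simp add: sum_ennreal inverse_ennreal)
  also have "\<dots> = ennreal ((\<Sum>k\<in>neighbours E i. h k) / real (deg E i))"
    using d s by (simp add: ennreal_mult' divide_inverse)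
  finally show ?thesis
    using d s by (simp flip: ennreal_1 ennreal_plus)
qed

text \<open>Hitting times are minimal among nonnegative solutions of the first-step equation: the
  bound passes from one partial sum to the next. Its main use is to show that they are
  finite.\<close>

lemma hitting_time_le:
  assumes h: "\<And>v. v \<in> V \<Longrightarrow> 0 \<le> h v"
    and step: "\<And>i. i \<in> V \<Longrightarrow> i \<noteq> j \<Longrightarrow> h i = 1 + (\<Sum>k\<in>neighbours E i. h k) / real (deg E i)"
    and i: "i \<in> V"
  shows "hitting_time E i j \<le> ennreal (h i)"
proof -
  have "(\<Sum>t<n. avoid_prob E j t i) \<le> ennreal (h i)" for n
    using i
  proof (induction n arbitrary: i)
    case (Suc n)
    show ?case
    proof (cases "i = j")
      case True
      then show ?thesis by (simp only: avoid_prob_self) simp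
    next
      case False
      let ?c = "inverse (ennreal (deg E i))"
      have "(\<Sum>t<Suc n. avoid_prob E j t i) = 1 + (\<Sum>t<n. avoid_prob E j (Suc t) i)"
        using False by (simp add: sum.lessThan_Suc_shift del: sum.lessThan_Suc)
      also have "\<dots> = 1 + (\<Sum>k\<in>neighbours E i. \<Sum>t<n. avoid_prob E j t k) * ?c"
        unfolding avoid_prob_Suc[OF Suc.prems False] by (subst sum.swap) (simp add: sum_distrib_right)
      also have "\<dots> \<le> 1 + (\<Sum>k\<in>neighbours E i. ennreal (h k)) * ?c"
        by (intro add_left_mono mult_right_mono sum_mono Suc.IH) (use neighbours_subset in auto)
      also have "\<dots> = ennreal (h i)"
        by (simp add: ennreal_first_step[OF Suc.prems h] step[OF Suc.prems False])
      finally show ?thesis .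
    qed
  qed simp
  then show ?thesis
    unfolding hitting_time_eq_suminf by (intro suminf_le_const summableI)
qed

text \<open>One inequality is \<open>hitting_time_le\<close>. For the other, the difference of
  \<open>h\<close> and the hitting time is harmonic off \<open>j\<close> and vanishes at
  \<open>j\<close>, so the maximum principle bounds it by 0.\<close>

lemma hitting_time_eqI:
  assumes h: "\<And>v. v \<in> V \<Longrightarrow> 0 \<le> h v" and hj: "h j = 0" and j: "j \<in> V"
    and lap: "\<And>i. i \<in> V \<Longrightarrow> i \<noteq> j \<Longrightarrow> (\<Sum>k\<in>neighbours E i. h i - h k) = real (deg E i)"
    and i: "i \<in> V"
  shows "hitting_time E i j = ennreal (h i)"
proof -
  have step_iff: "(\<Sum>k\<in>neighbours E v. g v - g k) = real (deg E v) \<longleftrightarrow>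
      g v = 1 + (\<Sum>k\<in>neighbours E v. g k) / real (deg E v)" if "v \<in> V" for g v
    using deg_pos[OF that] by (simp add: sum_subtractf field_simps) (auto simp: deg_def)
  \<comment> \<open>The bound \<open>le\<close> makes all hitting times finite, so nothing is lost
    in passing to the reals, where differences can be formed.\<close>
  define r where "r v = enn2real (hitting_time E v j)" for v
  have le: "hitting_time E v j \<le> ennreal (h v)" if "v \<in> V" for v
    by (rule hitting_time_le[OF h _ that]) (use lap step_iff in auto)
  have r: "hitting_time E v j = ennreal (r v)" if "v \<in> V" for v
    unfolding r_def using le[OF that] by (simp add: ennreal_enn2real_if) (metis ennreal_neq_top top.extremum_unique)
  have r_nonneg: "0 \<le> r v" for v by (simp add: r_def)
  have rj: "r j = 0" by (simp add: r_def hitting_time_self)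
  have r_lap: "(\<Sum>k\<in>neighbours E v. r v - r k) = real (deg E v)" if v: "v \<in> V" "v \<noteq> j" for v
  proof -
    have "ennreal (r v) = 1 + (\<Sum>k\<in>neighbours E v. ennreal (r k)) * inverse (ennreal (deg E v))"
      using hitting_time_step[OF v] r[OF v(1)] r neighbours_subset[of v] by (simp add: subset_iff)
    also have "\<dots> = ennreal (1 + (\<Sum>k\<in>neighbours E v. r k) / real (deg E v))"
      by (rule ennreal_first_step[OF v(1) r_nonneg])
    finally have "r v = 1 + (\<Sum>k\<in>neighbours E v. r k) / real (deg E v)"
      by (subst (asm) ennreal_inj) (simp_all add: r_nonneg sum_nonneg)
    then show ?thesis using step_iff[OF v(1), of r] by blast
  qed
  have harmonic: "(\<Sum>k\<in>neighbours E v. (h v - r v) - (h k - r k)) = 0"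
    if "v \<in> V" "v \<noteq> j" for v
  proof -
    have "(\<Sum>k\<in>neighbours E v. (h v - r v) - (h k - r k)) =
        (\<Sum>k\<in>neighbours E v. h v - h k) - (\<Sum>k\<in>neighbours E v. r v - r k)"
      by (simp flip: sum_subtractf add: algebra_simps)
    then show ?thesis using lap[OF that] r_lap[OF that] by simp
  qed
  have "h i - r i \<le> h j - r j"
    by (rule discrete_maximum_principle[OF j i]) (rule harmonic)
  moreover have "r i \<le> h i"
    using le[OF i] r[OF i] h[OF i] by simp
  ultimately show ?thesis using hj rj r[OF i] by simp
qed

lemma hitting_time_eq_forest_vol:
  assumes "i \<in> V" "j \<in> V"
  shows "hitting_time E i j = ennreal (forest_vol V E j i / real (card (spanning_trees V E)))"
proof (rule hitting_time_eqI[OF _ _ assms(2) _ assms(1)])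
  have pos: "0 < card (spanning_trees V E)"
    using spanning_trees_nonempty finite_spanning_trees by (simp add: card_gt_0_iff)
  show "(\<Sum>k\<in>neighbours E v. forest_vol V E j v / real (card (spanning_trees V E))
      - forest_vol V E j k / real (card (spanning_trees V E))) = real (deg E v)"
    if "v \<in> V" "v \<noteq> j" for v
    using forest_vol_laplacian[OF that(1) assms(2)] that(2) pos
    by (simp flip: diff_divide_distrib sum_divide_distrib)
qed (simp_all add: forest_vol_nonneg forest_vol_self)

lemma stationary_forest_vol_const:
  assumes i: "i \<in> V" and r: "r \<in> V"
  shows "(\<Sum>j\<in>V. real (deg E j) * forest_vol V E j i) = (\<Sum>j\<in>V. real (deg E j) * forest_vol V E j r)"
proof -
  let ?f = "\<lambda>v. \<Sum>j\<in>V. real (deg E j) * forest_vol V E j v"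
  have harmonic: "(\<Sum>k\<in>neighbours E v. ?f v - ?f k) = 0" if v: "v \<in> V" for v
  proof -
    have "(\<Sum>k\<in>neighbours E v. ?f v - ?f k) =
        (\<Sum>k\<in>neighbours E v. \<Sum>j\<in>V. real (deg E j) * (forest_vol V E j v - forest_vol V E j k))"
      by (simp add: sum_subtractf right_diff_distrib)
    also have "\<dots> = (\<Sum>j\<in>V. real (deg E j) *
        (\<Sum>k\<in>neighbours E v. forest_vol V E j v - forest_vol V E j k))"
      by (subst sum.swap) (simp add: sum_distrib_left)
    also have "\<dots> = (\<Sum>j\<in>V. real (card (spanning_trees V E)) *
        (real (deg E j) * real (deg E v) - (if v = j then real (deg E v) * real (vol E V) else 0)))"
      by (rule sum.cong[OF refl]) (auto simp: forest_vol_laplacian[OF v] algebra_simps)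
    \<comment> \<open>The degrees \<open>d(j)\<close> add up to vol(V), while the case distinction
      contributes only at \<open>j = v\<close>; the two terms cancel.\<close>
    also have "\<dots> = real (card (spanning_trees V E)) *
        (real (vol E V) * real (deg E v) - real (deg E v) * real (vol E V))"
      using finite_V v by (simp add: sum_subtractf vol_def flip: sum_distrib_left sum_distrib_right)
    finally show ?thesis by simp
  qed
  show ?thesis
    \<comment> \<open>Harmonicity holds at every vertex, so both \<open>r\<close> and
      \<open>i\<close> can play the exceptional vertex, giving the two inequalities.\<close>
    by (intro antisym discrete_maximum_principle[OF i r] discrete_maximum_principle[OF r i] harmonic)
qed

end

theorem mainTheorem1:
  fixes V :: "'a set" and E :: "'a set set" and r i :: 'a
  assumes "simple_graph V E"
    and "connected_graph V E"
    and "2 \<le> card V"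
    and "r \<in> V"
    and "i \<in> V"
  shows "kemeny V E i =
    ennreal (1 / (2 * real (card E) * real (card (spanning_trees V E))) *
      (\<Sum>u\<in>V - {r}. real (deg E u) *
        (\<Sum>F\<in>two_forests_separating V E r u. real (vol E (component_of V F r)))))"
proof -
  interpret nontrivial_connected_graph V E
    by unfold_locales (fact assms)+
  let ?m = "2 * real (card E)" and ?t = "real (card (spanning_trees V E))"
  have "kemeny V E i = (\<Sum>j\<in>V. ennreal (real (deg E j) / ?m * (forest_vol V E j i / ?t)))"
    unfolding kemeny_def
  proof (rule sum.cong[OF refl])
    fix j assume "j \<in> V"
    then have "hitting_time E i j = ennreal (forest_vol V E j i / ?t)"
      by (rule hitting_time_eq_forest_vol[OF assms(5)])
    then show "ennreal (real (deg E j) / ?m) * hitting_time E i j =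
        ennreal (real (deg E j) / ?m * (forest_vol V E j i / ?t))"
      by (simp only: ennreal_mult forest_vol_nonneg divide_nonneg_nonneg of_nat_0_le_iff
          mult_nonneg_nonneg zero_le_numeral)
  qed
  also have "\<dots> = ennreal (\<Sum>j\<in>V. real (deg E j) / ?m * (forest_vol V E j i / ?t))"
    by (rule sum_ennreal) (simp add: forest_vol_nonneg)
  also have "(\<Sum>j\<in>V. real (deg E j) / ?m * (forest_vol V E j i / ?t)) =
      1 / (?m * ?t) * (\<Sum>j\<in>V. real (deg E j) * forest_vol V E j i)"
    by (simp add: sum_distrib_left)
  \<comment> \<open>The start moves from \<open>i\<close> to \<open>r\<close>; the term
    \<open>u = r\<close> drops out because no 2-forest separates \<open>r\<close> from
    itself.\<close>
  also have "(\<Sum>j\<in>V. real (deg E j) * forest_vol V E j i) = (\<Sum>u\<in>V - {r}. real (deg E u) * forest_vol V E u r)"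
    unfolding stationary_forest_vol_const[OF assms(5,4)]
    by (simp add: sum.remove[OF finite_V assms(4)] forest_vol_self)
  finally show ?thesis
    by (simp only: forest_vol_def)
qed

end
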